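(* Let $X$ and $Y$ be separable Hilbert spaces and let $Q$ be the (injective, self-adjoint, positive, trace class) covariance operator of a nondegenerate centered Gaussian measure on $Y$. Let $F: X \to Y$ satisfy $\operatorname{ran}(F) \subseteq \operatorname{ran}(Q)$, assume that $Q^{-1}\circ F$ is Lipschitz continuous on bounded sets, and assume that there exists $L_0 > 0$ such that $$\|Q^{-1}F(u) - Q^{-1}F(0)\|_Y \le L_0\|u\|_X \quad \text{for all } u \in X.$$ Define $\Phi: X \times Y \to \mathbb{R}$ by $$\Phi(u,y) = \frac12\|Q^{-1/2}F(u)\|_Y^2 - (Q^{-1}F(u), y)_Y .$$ Then for every $y \in Y$: (i) $\Phi(\cdot,y)$ is Lipschitz continuous on bounded sets; (ii) there exists $\underline{L} \ge 0$ such that $\Phi(u,y) \ge \Phi(0,y) - \underline{L}\|u\|_X$ for all $u \in X$.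
   Context: $\operatorname{ran}$ denotes the range of a mapping. A map $G$ from $X$ into a normed space $W$ is Lipschitz continuous on bounded sets if for every $r > 0$ there exists $L = L(r) > 0$ such that $\|G(x_1) - G(x_2)\|_W \le L\|x_1 - x_2\|_X$ for all $x_1, x_2$ in the open ball $B_r(0) \subset X$. *)

theory Defs
  imports "HOL-Probability.Probability"
begin

text \<open>A Borel probability measure is centered Gaussian if all its one-dimensional marginals are
  centered normal distributions; variance 0 stands for the point mass at 0.\<close>

definition centered_gaussian_measure :: "'b::real_inner measure \<Rightarrow> bool" where
  "centered_gaussian_measure M \<longleftrightarrow>
     prob_space M \<and> sets M = sets borel \<and>
     (\<forall>v. \<exists>\<sigma>\<ge>0. distr M borel (\<lambda>x. v \<bullet> x) =
        (if \<sigma> = 0 then return borel 0 else density lborel (normal_density 0 \<sigma>)))"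

text \<open>No marginal in a nonzero direction is a point mass. For Gaussian measures this is equivalent
  to injectivity of the covariance operator.\<close>

definition nondegenerate_measure :: "'b::real_inner measure \<Rightarrow> bool" where
  "nondegenerate_measure M \<longleftrightarrow>
     (\<forall>v. v \<noteq> 0 \<longrightarrow> (\<forall>c. distr M borel (\<lambda>x. v \<bullet> x) \<noteq> return borel c))"

text \<open>Only meant for centered measures, since no mean is subtracted. The integrand is integrable
  for Gaussian measures, because all marginals have finite second moments.\<close>

definition covariance_operator :: "'b::real_inner measure \<Rightarrow> ('b \<Rightarrow> 'b) \<Rightarrow> bool" where
  "covariance_operator M Q \<longleftrightarrow>
     bounded_linear Q \<and> (\<forall>u v. Q u \<bullet> v = (\<integral>x. (u \<bullet> x) * (v \<bullet> x) \<partial>M))"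

definition positive_selfadjoint :: "('b::real_inner \<Rightarrow> 'b) \<Rightarrow> bool" where
  "positive_selfadjoint S \<longleftrightarrow>
     bounded_linear S \<and> (\<forall>u v. S u \<bullet> v = u \<bullet> S v) \<and> (\<forall>u. 0 \<le> S u \<bullet> u)"

text \<open>On a Hilbert space every positive self-adjoint operator has exactly one positive
  self-adjoint square root.\<close>

definition op_sqrt :: "('b::real_inner \<Rightarrow> 'b) \<Rightarrow> 'b \<Rightarrow> 'b" where
  "op_sqrt Q = (THE S. positive_selfadjoint S \<and> S \<circ> S = Q)"

definition lipschitz_on_bounded_sets ::
    "('a::real_normed_vector \<Rightarrow> 'c::real_normed_vector) \<Rightarrow> bool" where
  "lipschitz_on_bounded_sets G \<longleftrightarrow> (\<forall>r>0. \<exists>L>0. L-lipschitz_on (ball 0 r) G)"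

end

theory Submission
  imports Defs
begin

text \<open>Positive square roots exist and are unique, so with \<open>g = Q\<^sup>-\<^sup>1 \<circ> F\<close> one has
  \<open>norm (Q\<^sup>-\<^sup>1\<^sup>/\<^sup>2 (F u))\<^sup>2 = Q (g u) \<bullet> g u\<close>, and \<open>\<Phi> u y\<close> is the convex quadratic
  functional \<open>w \<mapsto> Q w \<bullet> w / 2 - w \<bullet> y\<close> evaluated at \<open>g u\<close>. It is Lipschitz on bounded sets because
  \<open>g\<close> is, and the lower bound is its tangent inequality at \<open>g 0\<close>.
  The square root of an operator with \<open>0 \<le> A \<le> 1\<close> is \<open>1 - B\<close>, where \<open>B\<close> is the limit of the
  iteration \<open>B \<leftarrow> (1 - A + B\<^sup>2) / 2\<close> started at 0; the increments of this iteration are dominated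
  by those of the scalar iteration \<open>b \<leftarrow> (1 + b\<^sup>2) / 2\<close>, which increases and stays below 1.\<close>

section \<open>Square roots of positive operators\<close>

lemma positive_selfadjointD:
  assumes "positive_selfadjoint S"
  shows "bounded_linear S" "S u \<bullet> v = u \<bullet> S v" "0 \<le> S u \<bullet> u"
  using assms by (auto simp: positive_selfadjoint_def)

text \<open>The form \<open>S u \<bullet> v\<close> is a semi-inner product, so the quadratic
  polynomial \<open>S (u - t *\<^sub>R v) \<bullet> (u - t *\<^sub>R v)\<close> in \<open>t\<close>
  is nonnegative. Since \<open>S\<close> may have a kernel, the case of a vanishing leading
  coefficient is treated separately.\<close>

lemma positive_selfadjoint_Cauchy_Schwarz:
  assumes "positive_selfadjoint S"
  shows "(S u \<bullet> v)\<^sup>2 \<le> (S u \<bullet> u) * (S v \<bullet> v)"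
proof -
  interpret bounded_linear S using assms by (rule positive_selfadjointD)
  note sa = positive_selfadjointD(2)[OF assms]
  have expand: "0 \<le> S u \<bullet> u - 2 * t * (S u \<bullet> v) + t\<^sup>2 * (S v \<bullet> v)" for t
  proof -
    have "S v \<bullet> u = S u \<bullet> v" using sa[of v u] by (simp add: inner_commute)
    then have "S (u - t *\<^sub>R v) \<bullet> (u - t *\<^sub>R v)
        = S u \<bullet> u - 2 * t * (S u \<bullet> v) + t\<^sup>2 * (S v \<bullet> v)"
      by (simp add: diff scaleR inner_diff_left inner_diff_right power2_eq_square algebra_simps)
    then show ?thesis using positive_selfadjointD(3)[OF assms] by metis
  qed
  show ?thesis
  proof (cases "S v \<bullet> v = 0")
    case True
    have "S u \<bullet> v = 0"
    proof (rule ccontr)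
      assume ne: "S u \<bullet> v \<noteq> 0"
      \<comment> \<open>With leading coefficient 0 the polynomial is affine in \<open>t\<close> with
        nonzero slope; the chosen \<open>t\<close> gives it the value -1.\<close>
      show False
        using expand[of "(S u \<bullet> u + 1) / (2 * (S u \<bullet> v))"] True ne by (simp add: field_simps)
    qed
    then show ?thesis using True by simp
  next
    case False
    then have pos: "0 < S v \<bullet> v" using positive_selfadjointD(3)[OF assms, of v] by simp
    \<comment> \<open>The value of \<open>t\<close> inserted here is the minimiser of the
      polynomial.\<close>
    have "0 \<le> S u \<bullet> u - (S u \<bullet> v)\<^sup>2 / (S v \<bullet> v)"
      using expand[of "(S u \<bullet> v) / (S v \<bullet> v)"] pos
      by (simp add: field_simps power2_eq_square)
    then show ?thesis using pos by (simp add: field_simps)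
  qed
qed

lemma positive_selfadjoint_eq_0:
  assumes "positive_selfadjoint S" "S u \<bullet> u = 0"
  shows "S u = 0"
  using positive_selfadjoint_Cauchy_Schwarz[OF assms(1), of u "S u"] assms(2) by simp

text \<open>The inequality \<open>S \<le> 1\<close> between quadratic forms becomes a norm bound:
  take \<open>v = S u\<close> in the Cauchy-Schwarz inequality for \<open>S\<close> and cancel the
  square of \<open>norm (S u)\<close>.\<close>

lemma positive_selfadjoint_norm_le:
  assumes "positive_selfadjoint S" "\<And>u. S u \<bullet> u \<le> (norm u)\<^sup>2"
  shows "norm (S u) \<le> norm u"
proof -
  have "(S u \<bullet> S u)\<^sup>2 \<le> (S u \<bullet> u) * (S (S u) \<bullet> S u)"
    by (rule positive_selfadjoint_Cauchy_Schwarz[OF assms(1)])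
  also have "\<dots> \<le> (norm u)\<^sup>2 * (norm (S u))\<^sup>2"
    by (intro mult_mono assms(2) positive_selfadjointD(3)[OF assms(1)]) auto
  finally have "(norm (S u))\<^sup>2 * (norm (S u))\<^sup>2 \<le> (norm u)\<^sup>2 * (norm (S u))\<^sup>2"
    by (simp add: dot_square_norm power2_eq_square)
  then have "S u = 0 \<or> (norm (S u))\<^sup>2 \<le> (norm u)\<^sup>2"
    unfolding mult_le_cancel_right by auto
  then show ?thesis by (auto simp: abs_le_square_iff[symmetric])
qed

section \<open>The iteration for the square root and its scalar majorant\<close>

text \<open>A fixed point \<open>B\<close> satisfies \<open>2 B = R + B\<^sup>2\<close>, that is,
  \<open>(1 - B)\<^sup>2 = 1 - R\<close>. With \<open>R = 1 - A\<close> this makes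
  \<open>1 - B\<close> a square root of \<open>A\<close>.\<close>

fun sqrt_iter :: "('b::real_inner \<Rightarrow> 'b) \<Rightarrow> nat \<Rightarrow> 'b \<Rightarrow> 'b" where
  "sqrt_iter R 0 u = 0"
| "sqrt_iter R (Suc n) u = (1/2) *\<^sub>R (R u + sqrt_iter R n (sqrt_iter R n u))"

text \<open>This is the same iteration for scalars with \<open>R = 1\<close>, the extreme case among
  all \<open>R\<close> of norm at most 1.\<close>

fun sqrt_iter_bound :: "nat \<Rightarrow> real" where
  "sqrt_iter_bound 0 = 0"
| "sqrt_iter_bound (Suc n) = (1 + (sqrt_iter_bound n)\<^sup>2) / 2"

lemma sqrt_iter_bound_range: "0 \<le> sqrt_iter_bound n" "sqrt_iter_bound n \<le> 1"
proof (induction n)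
  case (Suc n)
  { case 1 show ?case by simp }
  { case 2 show ?case using Suc by (simp add: power_le_one) }
qed auto

lemma sqrt_iter_bound_incseq: "incseq sqrt_iter_bound"
proof (rule incseq_SucI)
  fix n
  \<comment> \<open>Half of this square is the increment from \<open>n\<close> to
    \<open>Suc n\<close>.\<close>
  have "0 \<le> (1 - sqrt_iter_bound n)\<^sup>2" by simp
  then show "sqrt_iter_bound n \<le> sqrt_iter_bound (Suc n)"
    by (simp add: power2_eq_square algebra_simps)
qed

lemma sqrt_iter_linear:
  assumes "bounded_linear R"
  shows "bounded_linear (sqrt_iter R n)"
proof (induction n)
  case 0
  have "sqrt_iter R 0 = (\<lambda>u. 0)" by auto
  then show ?case by (simp add: bounded_linear_zero)
next
  case (Suc n)
  have "sqrt_iter R (Suc n) = (\<lambda>u. (1/2) *\<^sub>R (R u + sqrt_iter R n (sqrt_iter R n u)))" by auto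
  then show ?case
    by (simp only:)
       (intro bounded_linear_const_scaleR bounded_linear_add assms bounded_linear_compose[OF Suc Suc])
qed

lemma sqrt_iter_selfadjoint:
  assumes "\<And>u v. R u \<bullet> v = u \<bullet> R v"
  shows "sqrt_iter R n u \<bullet> v = u \<bullet> sqrt_iter R n v"
  by (induction n arbitrary: u v) (simp_all add: inner_add_left inner_add_right assms)

text \<open>Every iterate is a polynomial in \<open>R\<close>, so it commutes with whatever commutes
  with \<open>R\<close>. The property survives the passage to the limit and is what uniqueness of
  the square root rests on.\<close>

lemma sqrt_iter_commute:
  assumes "bounded_linear T" "\<And>u. T (R u) = R (T u)"
  shows "T (sqrt_iter R n u) = sqrt_iter R n (T u)"
proof -
  interpret T: bounded_linear T by fact
  show ?thesis
    by (induction n arbitrary: u) (simp_all add: T.zero T.add T.scaleR assms(2))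
qed

lemma sqrt_iter_norm:
  assumes "\<And>u. norm (R u) \<le> norm u"
  shows "norm (sqrt_iter R n u) \<le> sqrt_iter_bound n * norm u"
proof (induction n arbitrary: u)
  case (Suc n)
  have "norm (sqrt_iter R n (sqrt_iter R n u)) \<le> sqrt_iter_bound n * (sqrt_iter_bound n * norm u)"
    using Suc[of "sqrt_iter R n u"] mult_left_mono[OF Suc[of u] sqrt_iter_bound_range(1)[of n]]
    by linarith
  then have "norm (R u + sqrt_iter R n (sqrt_iter R n u)) \<le> (1 + (sqrt_iter_bound n)\<^sup>2) * norm u"
    using norm_triangle_ineq[of "R u" "sqrt_iter R n (sqrt_iter R n u)"] assms[of u]
    by (simp add: power2_eq_square algebra_simps)
  then show ?case by simp
qed simp

text \<open>For consecutive iterates \<open>B\<close>, \<open>C\<close> with scalar bounds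
  \<open>b\<close>, \<open>c\<close>, write \<open>C C - B B = C (C - B) + (C - B) B\<close>. The
  two terms are bounded by \<open>c (c - b)\<close> and \<open>(c - b) b\<close>, which add up to
  \<open>c\<^sup>2 - b\<^sup>2\<close>, exactly twice the next scalar increment.\<close>

lemma sqrt_iter_increment:
  assumes "bounded_linear R" "\<And>u. norm (R u) \<le> norm u"
  shows "norm (sqrt_iter R (Suc n) u - sqrt_iter R n u)
    \<le> (sqrt_iter_bound (Suc n) - sqrt_iter_bound n) * norm u"
proof (induction n arbitrary: u)
  case 0
  show ?case using assms(2)[of u] by simp
next
  case (Suc n)
  define B where "B = sqrt_iter R n"
  define C where "C = sqrt_iter R (Suc n)"
  define b where "b = sqrt_iter_bound n"
  define c where "c = sqrt_iter_bound (Suc n)"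
  have bc: "0 \<le> b" "0 \<le> c" "b \<le> c"
    using sqrt_iter_bound_range(1) incseq_SucD[OF sqrt_iter_bound_incseq, of n]
    by (auto simp: b_def c_def simp del: sqrt_iter_bound.simps)
  have IH: "norm (C w - B w) \<le> (c - b) * norm w" for w
    using Suc[of w] unfolding B_def C_def b_def c_def .
  have B: "norm (B w) \<le> b * norm w" and C: "norm (C w) \<le> c * norm w" for w
    unfolding B_def C_def b_def c_def using sqrt_iter_norm[OF assms(2)] by blast+
  have lin: "C (C u - B u) = C (C u) - C (B u)"
    using bounded_linear.linear[OF sqrt_iter_linear[OF assms(1)]]
    unfolding C_def by (rule linear_diff)
  have "C (C u) - B (B u) = C (C u - B u) + (C (B u) - B (B u))"
    by (simp add: lin)
  also have "norm \<dots> \<le> norm (C (C u - B u)) + norm (C (B u) - B (B u))"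
    by (rule norm_triangle_ineq)
  also have "\<dots> \<le> c * ((c - b) * norm u) + (c - b) * (b * norm u)"
    using C[of "C u - B u"] IH[of "B u"] mult_left_mono[OF IH[of u] bc(2)]
      mult_left_mono[OF B[of u], of "c - b"] bc(3) by linarith
  also have "\<dots> = (c\<^sup>2 - b\<^sup>2) * norm u" by (simp add: power2_eq_square algebra_simps)
  finally have main: "norm (C (C u) - B (B u)) \<le> (c\<^sup>2 - b\<^sup>2) * norm u" .
  have "sqrt_iter R (Suc (Suc n)) u - sqrt_iter R (Suc n) u = (1/2) *\<^sub>R (C (C u) - B (B u))"
    using sqrt_iter.simps(2)[of R "Suc n" u, folded C_def]
      sqrt_iter.simps(2)[of R n u, folded B_def C_def]
    unfolding C_def[symmetric] by (simp add: algebra_simps del: sqrt_iter.simps)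
  then have "norm (sqrt_iter R (Suc (Suc n)) u - sqrt_iter R (Suc n) u)
      = norm (C (C u) - B (B u)) / 2"
    by simp
  moreover have "sqrt_iter_bound (Suc (Suc n)) - sqrt_iter_bound (Suc n) = (c\<^sup>2 - b\<^sup>2) / 2"
    unfolding b_def c_def by (simp add: field_simps)
  ultimately show ?case using main by (simp only:)
qed

text \<open>The increments telescope, so distances between iterates are at most distances in the
  scalar sequence times \<open>norm u\<close>; the latter converges because it increases and is
  bounded.\<close>

lemma sqrt_iter_Cauchy:
  assumes "bounded_linear R" "\<And>u. norm (R u) \<le> norm u"
  shows "Cauchy (\<lambda>n. sqrt_iter R n u)"
proof -
  have le: "norm (sqrt_iter R n u - sqrt_iter R m u)
      \<le> (sqrt_iter_bound n - sqrt_iter_bound m) * norm u" if "m \<le> n" for m n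
    using that
  proof (induction n rule: dec_induct)
    case (step n)
    have "norm (sqrt_iter R (Suc n) u - sqrt_iter R m u)
      \<le> norm (sqrt_iter R (Suc n) u - sqrt_iter R n u) + norm (sqrt_iter R n u - sqrt_iter R m u)"
      by (rule norm_diff_triangle_le[OF order_refl order_refl])
    then show ?case
      using step.IH sqrt_iter_increment[OF assms, of n u]
      by (simp add: algebra_simps del: sqrt_iter.simps sqrt_iter_bound.simps)
  qed simp
  obtain l where "sqrt_iter_bound \<longlonglongrightarrow> l"
    using incseq_convergent[OF sqrt_iter_bound_incseq, of 1] sqrt_iter_bound_range(2) by blast
  then have "(\<lambda>n. sqrt_iter_bound n * norm u) \<longlonglongrightarrow> l * norm u" by (intro tendsto_intros)
  then have "Cauchy (\<lambda>n. sqrt_iter_bound n * norm u)" by (rule LIMSEQ_imp_Cauchy)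
  show ?thesis
    unfolding Cauchy_altdef
  proof (intro allI impI)
    fix e :: real assume "0 < e"
    then obtain M where M: "\<And>m n. M \<le> m \<Longrightarrow> m < n \<Longrightarrow>
        \<bar>sqrt_iter_bound m * norm u - sqrt_iter_bound n * norm u\<bar> < e"
      using \<open>Cauchy _\<close> unfolding Cauchy_altdef dist_real_def by blast
    have "dist (sqrt_iter R m u) (sqrt_iter R n u) < e" if "M \<le> m" "m < n" for m n
    proof -
      have "norm (sqrt_iter R n u - sqrt_iter R m u)
          \<le> sqrt_iter_bound n * norm u - sqrt_iter_bound m * norm u"
        using le[of m n] that by (simp add: left_diff_distrib)
      then show ?thesis
        using M[OF that] by (simp add: dist_norm norm_minus_commute)
    qed
    then show "\<exists>M. \<forall>m\<ge>M. \<forall>n>m. dist (sqrt_iter R m u) (sqrt_iter R n u) < e" by blast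
  qed
qed

section \<open>Existence and uniqueness of the positive square root\<close>

text \<open>The third property is there for uniqueness: a square root \<open>T\<close> of
  \<open>A\<close> commutes with \<open>A\<close>, hence with the \<open>S\<close> constructed
  here.\<close>

lemma positive_sqrt_commuting:
  fixes A :: "'b::{real_inner, complete_space} \<Rightarrow> 'b"
  assumes A: "positive_selfadjoint A"
  obtains S where "positive_selfadjoint S" "\<And>u. S (S u) = A u"
    "\<And>T u. bounded_linear T \<Longrightarrow> (\<And>v. T (A v) = A (T v)) \<Longrightarrow> T (S u) = S (T u)"
proof -
  interpret A: bounded_linear A using A by (rule positive_selfadjointD)
  obtain K where K: "0 < K" "\<And>u. norm (A u) \<le> norm u * K"
    using A.pos_bounded by blast
  \<comment> \<open>Dividing by the norm bound \<open>K\<close> brings the operator between 0 and 1,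
    so \<open>R\<close> also lies between 0 and 1 and has norm at most 1.\<close>
  define R where "R u = u - (1/K) *\<^sub>R A u" for u
  have R_lin: "bounded_linear R"
    unfolding R_def
    by (intro bounded_linear_sub bounded_linear_ident bounded_linear_const_scaleR A.bounded_linear_axioms)
  have R_sa: "R u \<bullet> v = u \<bullet> R v" for u v
    by (simp add: R_def inner_diff_left inner_diff_right positive_selfadjointD(2)[OF A])
  have "A u \<bullet> u \<le> K * (u \<bullet> u)" for u
  proof -
    have "A u \<bullet> u \<le> norm (A u) * norm u" by (rule norm_cauchy_schwarz)
    also have "\<dots> \<le> (norm u * K) * norm u" by (intro mult_right_mono K) auto
    finally show ?thesis by (simp add: dot_square_norm power2_eq_square mult_ac)
  qed
  then have "0 \<le> R u \<bullet> u" for u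
    using K(1) by (simp add: R_def inner_diff_left field_simps)
  then have R_pos: "positive_selfadjoint R"
    unfolding positive_selfadjoint_def using R_lin R_sa by blast
  have R_norm: "norm (R u) \<le> norm u" for u
    by (rule positive_selfadjoint_norm_le[OF R_pos])
       (simp add: R_def inner_diff_left dot_square_norm positive_selfadjointD(3)[OF A] K(1) less_imp_le)
  define B where "B u = lim (\<lambda>n. sqrt_iter R n u)" for u
  have lim: "(\<lambda>n. sqrt_iter R n u) \<longlonglongrightarrow> B u" for u
    unfolding B_def
    using Cauchy_convergent[OF sqrt_iter_Cauchy[OF R_lin R_norm]] by (simp add: convergent_LIMSEQ_iff)
  have iter_norm: "norm (sqrt_iter R n u) \<le> norm u" for n u
    using sqrt_iter_norm[OF R_norm, of n u]
      mult_right_mono[OF sqrt_iter_bound_range(2)[of n] norm_ge_zero[of u]] by simp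
  have B_norm: "norm (B u) \<le> norm u" for u
    by (rule LIMSEQ_le_const2[OF tendsto_norm[OF lim]]) (use iter_norm in blast)
  have iter_lin: "linear (sqrt_iter R n)" for n
    using sqrt_iter_linear[OF R_lin] by (rule bounded_linear.linear)
  have B_lin: "bounded_linear B"
  proof (rule bounded_linear_intro)
    fix u v
    have "(\<lambda>n. sqrt_iter R n (u + v)) \<longlonglongrightarrow> B u + B v"
      using tendsto_add[OF lim lim] by (simp add: linear_add[OF iter_lin])
    then show "B (u + v) = B u + B v" using lim LIMSEQ_unique by blast
  next
    fix r :: real and u
    have "(\<lambda>n. sqrt_iter R n (r *\<^sub>R u)) \<longlonglongrightarrow> r *\<^sub>R B u"
      using tendsto_scaleR[OF tendsto_const lim] by (simp add: linear_scale[OF iter_lin])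
    then show "B (r *\<^sub>R u) = r *\<^sub>R B u" using lim LIMSEQ_unique by blast
  next
    fix u show "norm (B u) \<le> norm u * 1" using B_norm by simp
  qed
  interpret B: bounded_linear B by (rule B_lin)
  have B_sa: "B u \<bullet> v = u \<bullet> B v" for u v
  proof -
    have "(\<lambda>n. sqrt_iter R n u \<bullet> v) \<longlonglongrightarrow> B u \<bullet> v" "(\<lambda>n. u \<bullet> sqrt_iter R n v) \<longlonglongrightarrow> u \<bullet> B v"
      by (intro tendsto_intros lim)+
    then show ?thesis using LIMSEQ_unique by (simp add: sqrt_iter_selfadjoint[OF R_sa])
  qed
  have B_fix: "B u = (1/2) *\<^sub>R (R u + B (B u))" for u
  proof -
    \<comment> \<open>Both the operator and its argument vary with \<open>n\<close>. All iterates
      are nonexpansive, so replacing the inner iterate by its limit \<open>B u\<close> costs an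
      error that tends to 0.\<close>
    have "(\<lambda>n. sqrt_iter R n (sqrt_iter R n u - B u)) \<longlonglongrightarrow> 0"
    proof (rule Lim_null_comparison)
      show "\<forall>\<^sub>F n in sequentially. norm (sqrt_iter R n (sqrt_iter R n u - B u))
          \<le> norm (sqrt_iter R n u - B u)"
        using iter_norm by simp
      show "(\<lambda>n. norm (sqrt_iter R n u - B u)) \<longlonglongrightarrow> 0"
        using lim[of u] by (simp add: LIM_zero tendsto_norm_zero)
    qed
    from tendsto_add[OF this lim[of "B u"]]
    have "(\<lambda>n. sqrt_iter R n (sqrt_iter R n u)) \<longlonglongrightarrow> B (B u)"
      by (simp add: linear_diff[OF iter_lin])
    then have "(\<lambda>n. sqrt_iter R (Suc n) u) \<longlonglongrightarrow> (1/2) *\<^sub>R (R u + B (B u))"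
      unfolding sqrt_iter.simps by (intro tendsto_intros)
    then show ?thesis using LIMSEQ_Suc[OF lim[of u]] LIMSEQ_unique by blast
  qed
  \<comment> \<open>The fixed-point equation gives \<open>(1 - B)\<^sup>2 = A / K\<close>; the
    factor \<open>sqrt K\<close> undoes the scaling.\<close>
  define S where "S u = sqrt K *\<^sub>R (u - B u)" for u
  show thesis
  proof (rule that)
    have "0 \<le> S u \<bullet> u" for u
    proof -
      have "B u \<bullet> u \<le> norm (B u) * norm u" by (rule norm_cauchy_schwarz)
      also have "\<dots> \<le> norm u * norm u" by (intro mult_right_mono B_norm) auto
      finally show ?thesis
        using K(1) by (simp add: S_def inner_diff_left dot_square_norm power2_eq_square)
    qed
    moreover have "bounded_linear S"
      unfolding S_def by (intro bounded_linear_const_scaleR bounded_linear_sub bounded_linear_ident B_lin)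
    moreover have "S u \<bullet> v = u \<bullet> S v" for u v
      by (simp add: S_def inner_diff_left inner_diff_right B_sa)
    ultimately show "positive_selfadjoint S" by (simp add: positive_selfadjoint_def)
  next
    fix u
    have "2 *\<^sub>R B u = R u + B (B u)" using arg_cong[OF B_fix[of u], of "scaleR 2"] by simp
    then have "B (B u) = 2 *\<^sub>R B u - R u" by simp
    then have "u - B u - B (u - B u) = (1/K) *\<^sub>R A u"
      by (simp add: B.diff R_def scaleR_2 algebra_simps)
    moreover have "S (S u) = K *\<^sub>R (u - B u - B (u - B u))"
      using K(1) by (simp add: S_def B.scaleR B.diff scaleR_diff_right)
    ultimately show "S (S u) = A u" using K(1) by simp
  next
    fix T :: "'b \<Rightarrow> 'b" and u
    assume T: "bounded_linear T" and comm: "\<And>v. T (A v) = A (T v)"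
    interpret T: bounded_linear T by fact
    have "T (R v) = R (T v)" for v by (simp add: R_def T.diff T.scaleR comm)
    then have "(\<lambda>n. sqrt_iter R n (T u)) \<longlonglongrightarrow> T (B u)"
      using T.tendsto[OF lim[of u]] by (simp add: sqrt_iter_commute[OF T])
    then have "T (B u) = B (T u)" using lim LIMSEQ_unique by blast
    then show "T (S u) = S (T u)" by (simp add: S_def T.diff T.scaleR)
  qed
qed

text \<open>By commutation \<open>(S + T) (S - T) = S\<^sup>2 - T\<^sup>2 = 0\<close>. For
  \<open>d = (S - T) u\<close> the nonnegative numbers \<open>S d \<bullet> d\<close> and
  \<open>T d \<bullet> d\<close> therefore add up to 0, so \<open>S d = T d = 0\<close>, and
  self-adjointness gives \<open>d \<bullet> d = u \<bullet> (S - T) d = 0\<close>.\<close>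

lemma commuting_positive_sqrt_unique:
  assumes S: "positive_selfadjoint S" and T: "positive_selfadjoint T"
    and sq: "\<And>u. S (S u) = T (T u)" and comm: "\<And>u. T (S u) = S (T u)"
  shows "S u = T u"
proof -
  interpret S: bounded_linear S using S by (rule positive_selfadjointD)
  interpret T: bounded_linear T using T by (rule positive_selfadjointD)
  define d where "d = S u - T u"
  have "S d + T d = 0" by (simp add: d_def S.diff T.diff sq comm)
  then have "S d \<bullet> d + T d \<bullet> d = 0" by (simp flip: inner_add_left)
  then have "S d \<bullet> d = 0" "T d \<bullet> d = 0"
    using positive_selfadjointD(3)[OF S, of d] positive_selfadjointD(3)[OF T, of d] by linarith+
  then have "S d = 0" "T d = 0" using positive_selfadjoint_eq_0 S T by blast+
  moreover have "d \<bullet> d = u \<bullet> S d - u \<bullet> T d"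
    by (simp add: positive_selfadjointD(2)[OF S, symmetric] positive_selfadjointD(2)[OF T, symmetric])
       (simp add: d_def inner_diff_left)
  ultimately have "d \<bullet> d = 0" by simp
  then show ?thesis by (simp add: d_def)
qed

lemma op_sqrt:
  fixes A :: "'b::{real_inner, complete_space} \<Rightarrow> 'b"
  assumes A: "positive_selfadjoint A"
  shows "positive_selfadjoint (op_sqrt A)" "op_sqrt A (op_sqrt A u) = A u"
proof -
  obtain S where S: "positive_selfadjoint S" "\<And>u. S (S u) = A u"
    "\<And>T u. bounded_linear T \<Longrightarrow> (\<And>v. T (A v) = A (T v)) \<Longrightarrow> T (S u) = S (T u)"
    using positive_sqrt_commuting[OF A] by blast
  have "\<exists>!S. positive_selfadjoint S \<and> S \<circ> S = A"
  proof (rule ex1I)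
    show "positive_selfadjoint S \<and> S \<circ> S = A" using S by auto
  next
    fix T assume "positive_selfadjoint T \<and> T \<circ> T = A"
    then have T: "positive_selfadjoint T" and TT: "A u = T (T u)" for u by auto
    \<comment> \<open>Both \<open>T (A v)\<close> and \<open>A (T v)\<close> are the threefold
      application of \<open>T\<close> to \<open>v\<close>.\<close>
    have comm: "T (S u) = S (T u)" for u
      by (rule S(3)) (simp_all only: positive_selfadjointD(1)[OF T] TT)
    have "S u = T u" for u
      by (rule commuting_positive_sqrt_unique[OF S(1) T]) (simp_all only: S(2) TT comm)
    then show "T = S" by auto
  qed
  from theI'[OF this, folded op_sqrt_def]
  show "positive_selfadjoint (op_sqrt A)" "op_sqrt A (op_sqrt A u) = A u"
    by (auto simp: fun_eq_iff)
qed

text \<open>The root \<open>S\<close> inherits injectivity from \<open>S \<circ> S = A\<close>.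
  Hence the preimage of \<open>A w = S (S w)\<close> under \<open>S\<close> is \<open>S w\<close>,
  whose squared norm is \<open>S (S w) \<bullet> w\<close>.\<close>

lemma norm_inv_op_sqrt:
  fixes A :: "'b::{real_inner, complete_space} \<Rightarrow> 'b"
  assumes A: "positive_selfadjoint A" and "inj A"
  shows "(norm (inv (op_sqrt A) (A w)))\<^sup>2 = A w \<bullet> w"
proof -
  note S = op_sqrt[OF A]
  have "inj (op_sqrt A)" using \<open>inj A\<close> S(2) by (metis injD injI)
  then have "inv (op_sqrt A) (A w) = op_sqrt A w" by (metis S(2) inv_f_f)
  then show ?thesis
    using positive_selfadjointD(2)[OF S(1), of "op_sqrt A w" w]
    by (simp add: dot_square_norm[symmetric] S(2))
qed

section \<open>Covariance operators\<close>

lemma covariance_operator_positive_selfadjoint: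
  assumes "covariance_operator M Q"
  shows "positive_selfadjoint Q"
proof -
  have Q: "Q u \<bullet> v = (\<integral>x. (u \<bullet> x) * (v \<bullet> x) \<partial>M)" for u v
    using assms by (simp add: covariance_operator_def)
  have "Q u \<bullet> v = u \<bullet> Q v" for u v
    by (subst inner_commute[of u]) (simp add: Q mult.commute)
  moreover have "0 \<le> Q u \<bullet> u" for u by (simp add: Q)
  ultimately show ?thesis
    using assms by (simp add: positive_selfadjoint_def covariance_operator_def)
qed

text \<open>The number \<open>Q v \<bullet> v\<close> is the variance of the marginal in direction
  \<open>v\<close>. For \<open>v \<noteq> 0\<close> nondegeneracy excludes the point mass, so this
  variance is some \<open>\<sigma>\<^sup>2 > 0\<close> and \<open>Q v\<close> cannot vanish.\<close>

lemma covariance_operator_inj: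
  assumes M: "centered_gaussian_measure M" "nondegenerate_measure M"
    and Q: "covariance_operator M Q"
  shows "inj Q"
proof -
  interpret bounded_linear Q using Q by (simp add: covariance_operator_def)
  have [measurable_cong]: "sets M = sets borel" using M by (simp add: centered_gaussian_measure_def)
  have "v = 0" if "Q v = 0" for v
  proof (rule ccontr)
    assume "v \<noteq> 0"
    obtain \<sigma> where \<sigma>: "0 \<le> \<sigma>" "distr M borel (\<lambda>x. v \<bullet> x) =
        (if \<sigma> = 0 then return borel 0 else density lborel (normal_density 0 \<sigma>))"
      using M(1) unfolding centered_gaussian_measure_def by blast
    have "\<sigma> \<noteq> 0" using \<sigma>(2) M(2) \<open>v \<noteq> 0\<close> unfolding nondegenerate_measure_def by metis
    then have "0 < \<sigma>" using \<sigma>(1) by simp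
    have "0 = (\<integral>x. (v \<bullet> x)\<^sup>2 \<partial>M)"
      using Q that unfolding covariance_operator_def power2_eq_square by (metis inner_zero_left)
    also have "\<dots> = (\<integral>t. t\<^sup>2 \<partial>distr M borel (\<lambda>x. v \<bullet> x))"
    proof (rule integral_distr[symmetric])
      have "(\<lambda>x. v \<bullet> x) \<in> borel_measurable borel"
        by (intro borel_measurable_continuous_onI continuous_intros)
      then show "(\<lambda>x. v \<bullet> x) \<in> borel_measurable M"
        by (simp cong: measurable_cong_sets)
    qed measurable
    also have "\<dots> = (\<integral>t. normal_density 0 \<sigma> t * t\<^sup>2 \<partial>lborel)"
      using \<sigma> \<open>\<sigma> \<noteq> 0\<close> by (simp add: integral_real_density)
    \<comment> \<open>The second moment is the case \<open>k = 1\<close> of the formula for the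
      moments of order \<open>2 * k\<close>.\<close>
    also have "\<dots> = \<sigma>\<^sup>2"
      using integral_normal_moment_even[OF \<open>0 < \<sigma>\<close>, of 0 1]
      by (simp add: fact_numeral)
    finally show False using \<open>0 < \<sigma>\<close> by simp
  qed
  then show ?thesis by (auto simp: linear_injective_0[OF linear])
qed

section \<open>The potential\<close>

text \<open>A map that is Lipschitz on a ball sends it into a ball, of radius \<open>s\<close>
  below, and there the outer map has a Lipschitz constant of its own.\<close>

lemma lipschitz_on_bounded_sets_comp:
  fixes h :: "'c::real_normed_vector \<Rightarrow> 'd::real_normed_vector"
  assumes h: "lipschitz_on_bounded_sets h" and g: "lipschitz_on_bounded_sets g"
  shows "lipschitz_on_bounded_sets (\<lambda>u. h (g u))"
  unfolding lipschitz_on_bounded_sets_def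
proof (intro allI impI)
  fix r :: real assume "0 < r"
  then obtain L where L: "0 < L" "L-lipschitz_on (ball 0 r) g"
    using g unfolding lipschitz_on_bounded_sets_def by blast
  define s where "s = norm (g 0) + L * r"
  have sub: "g ` ball 0 r \<subseteq> ball 0 s"
  proof clarify
    fix u :: 'a assume u: "u \<in> ball 0 r"
    then have "norm (g u - g 0) \<le> L * norm u"
      using lipschitz_on_normD[OF L(2) u, of 0] \<open>0 < r\<close> by simp
    also have "\<dots> < L * r" using u L(1) by simp
    finally show "g u \<in> ball 0 s"
      using norm_triangle_sub[of "g u" "g 0"] by (simp add: s_def)
  qed
  have "0 < s" using L(1) \<open>0 < r\<close> by (simp add: s_def add_nonneg_pos)
  then obtain N where N: "0 < N" "N-lipschitz_on (ball 0 s) h"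
    using h unfolding lipschitz_on_bounded_sets_def by blast
  have "(N * L)-lipschitz_on (ball 0 r) (\<lambda>u. h (g u))"
    by (rule lipschitz_on_compose2[OF L(2) lipschitz_on_subset[OF N(2) sub]])
  then show "\<exists>L>0. L-lipschitz_on (ball 0 r) (\<lambda>u. h (g u))"
    using L(1) N(1) by (meson mult_pos_pos)
qed

lemma quadratic_functional_lipschitz:
  fixes Q :: "'b::real_inner \<Rightarrow> 'b"
  assumes Q: "positive_selfadjoint Q"
  shows "lipschitz_on_bounded_sets (\<lambda>w. 1/2 * (Q w \<bullet> w) - w \<bullet> y)"
  unfolding lipschitz_on_bounded_sets_def
proof (intro allI impI)
  interpret bounded_linear Q using Q by (rule positive_selfadjointD)
  obtain K where K: "0 < K" "\<And>u. norm (Q u) \<le> norm u * K"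
    using pos_bounded by blast
  fix r :: real assume r: "0 < r"
  have "(K * r + norm y)-lipschitz_on (ball 0 r) (\<lambda>w. 1/2 * (Q w \<bullet> w) - w \<bullet> y)"
  proof (rule lipschitz_onI)
    fix v w :: 'b assume vw: "v \<in> ball 0 r" "w \<in> ball 0 r"
    \<comment> \<open>Self-adjointness allows the difference of squares to be factored;
      \<open>v - w\<close> then splits off the whole difference, and the other factor is bounded
      because \<open>v + w\<close> has norm at most \<open>2 * r\<close>.\<close>
    have "Q v \<bullet> v - Q w \<bullet> w = Q (v + w) \<bullet> (v - w)"
      using positive_selfadjointD(2)[OF Q, of w v] inner_commute[of w "Q v"]
      by (simp add: add inner_add_left inner_diff_right)
    then have "(1/2 * (Q v \<bullet> v) - v \<bullet> y) - (1/2 * (Q w \<bullet> w) - w \<bullet> y)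
        = ((1/2) *\<^sub>R Q (v + w) - y) \<bullet> (v - w)"
      by (simp add: inner_diff_left inner_diff_right inner_commute field_simps)
    also have "\<bar>\<dots>\<bar> \<le> norm ((1/2) *\<^sub>R Q (v + w) - y) * norm (v - w)"
      by (rule Cauchy_Schwarz_ineq2)
    also have "\<dots> \<le> (K * r + norm y) * norm (v - w)"
    proof (rule mult_right_mono)
      have "norm (v + w) \<le> 2 * r" using vw norm_triangle_ineq[of v w] by simp
      then have "norm (Q (v + w)) \<le> 2 * r * K"
        using K(2)[of "v + w"] mult_right_mono[of "norm (v + w)" "2 * r" K] K(1) by linarith
      then show "norm ((1/2) *\<^sub>R Q (v + w) - y) \<le> K * r + norm y"
        using norm_triangle_ineq4[of "(1/2) *\<^sub>R Q (v + w)" y] by (simp add: mult.commute)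
    qed simp
    finally show "dist (1/2 * (Q v \<bullet> v) - v \<bullet> y) (1/2 * (Q w \<bullet> w) - w \<bullet> y)
        \<le> (K * r + norm y) * dist v w"
      by (simp only: dist_norm real_norm_def)
  qed (use K r in simp)
  then show "\<exists>L>0. L-lipschitz_on (ball 0 r) (\<lambda>w. 1/2 * (Q w \<bullet> w) - w \<bullet> y)"
    using K(1) r by (meson add_pos_nonneg mult_pos_pos norm_ge_zero)
qed

text \<open>The gradient at \<open>v\<close> is \<open>Q v - y\<close>, and the two sides differ by
  \<open>Q (w - v) \<bullet> (w - v) / 2\<close>, which is nonnegative.\<close>

lemma quadratic_functional_tangent:
  fixes Q :: "'b::real_inner \<Rightarrow> 'b"
  assumes Q: "positive_selfadjoint Q"
  shows "1/2 * (Q v \<bullet> v) - v \<bullet> y + (Q v - y) \<bullet> (w - v) \<le> 1/2 * (Q w \<bullet> w) - w \<bullet> y"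
proof -
  interpret bounded_linear Q using Q by (rule positive_selfadjointD)
  have "0 \<le> Q (w - v) \<bullet> (w - v)" by (rule positive_selfadjointD(3)[OF Q])
  also have "\<dots> = Q w \<bullet> w - 2 * (Q v \<bullet> w) + Q v \<bullet> v"
    using positive_selfadjointD(2)[OF Q, of w v]
    by (simp add: diff inner_diff_left inner_diff_right inner_commute)
  finally show ?thesis
    by (simp add: inner_diff_left inner_diff_right inner_commute)
qed

theorem proposition3p2:
  fixes F :: "'a::{real_inner, complete_space, second_countable_topology} \<Rightarrow>
              'b::{real_inner, complete_space, second_countable_topology}"
    and \<mu> :: "'b measure"
    and Q :: "'b \<Rightarrow> 'b"
    and \<Phi> :: "'a \<Rightarrow> 'b \<Rightarrow> real"
  assumes "centered_gaussian_measure \<mu>"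
    and "nondegenerate_measure \<mu>"
    and "covariance_operator \<mu> Q"
    and "range F \<subseteq> range Q"
    and "lipschitz_on_bounded_sets (inv Q \<circ> F)"
    and "\<exists>L0>0. \<forall>u. norm (inv Q (F u) - inv Q (F 0)) \<le> L0 * norm u"
    and "\<And>u y. \<Phi> u y = 1/2 * (norm (inv (op_sqrt Q) (F u)))\<^sup>2 - inv Q (F u) \<bullet> y"
  shows "\<forall>y. lipschitz_on_bounded_sets (\<lambda>u. \<Phi> u y) \<and>
             (\<exists>L\<ge>0. \<forall>u. \<Phi> u y \<ge> \<Phi> 0 y - L * norm u)"
proof
  fix y
  have Q: "positive_selfadjoint Q" "inj Q"
    using covariance_operator_positive_selfadjoint covariance_operator_inj assms(1-3) by blast+
  define g where "g = inv Q \<circ> F"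
  \<comment> \<open>\<open>inv Q\<close> is a right inverse of \<open>Q\<close> on
    \<open>range Q\<close>, which contains all values of \<open>F\<close>.\<close>
  have "F u = Q (g u)" for u
    using assms(4) by (auto simp: g_def f_inv_into_f subset_iff)
  then have \<Phi>: "\<Phi> u y = 1/2 * (Q (g u) \<bullet> g u) - g u \<bullet> y" for u
    by (simp add: assms(7) norm_inv_op_sqrt[OF Q] inv_f_f[OF Q(2)])
  have "lipschitz_on_bounded_sets (\<lambda>u. \<Phi> u y)"
    unfolding \<Phi> using quadratic_functional_lipschitz[OF Q(1)] assms(5)[folded g_def]
    by (rule lipschitz_on_bounded_sets_comp)
  moreover have "\<exists>L\<ge>0. \<forall>u. \<Phi> u y \<ge> \<Phi> 0 y - L * norm u"
  proof -
    obtain L0 where L0: "0 < L0" "\<And>u. norm (g u - g 0) \<le> L0 * norm u"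
      using assms(6) by (auto simp: g_def)
    \<comment> \<open>The constant is the norm of the gradient at \<open>g 0\<close> times the
      linear growth constant of \<open>g\<close>.\<close>
    have "\<Phi> u y \<ge> \<Phi> 0 y - norm (Q (g 0) - y) * L0 * norm u" for u
    proof -
      have "\<bar>(Q (g 0) - y) \<bullet> (g u - g 0)\<bar> \<le> norm (Q (g 0) - y) * norm (g u - g 0)"
        by (rule Cauchy_Schwarz_ineq2)
      also have "\<dots> \<le> norm (Q (g 0) - y) * (L0 * norm u)"
        by (intro mult_left_mono L0) auto
      finally show ?thesis
        using quadratic_functional_tangent[OF Q(1), of "g 0" y "g u"] unfolding \<Phi>
        by (simp add: mult.assoc)
    qed
    then show ?thesis using L0(1) by (meson less_imp_le mult_nonneg_nonneg norm_ge_zero)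
  qed
  ultimately show "lipschitz_on_bounded_sets (\<lambda>u. \<Phi> u y) \<and>
      (\<exists>L\<ge>0. \<forall>u. \<Phi> u y \<ge> \<Phi> 0 y - L * norm u)" by blast
qed

end
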